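(* Let $L$ be a set. The number of distinct $L$-isometry classes of compact $L$-labeled metric spaces is bounded from above by $2^{\max\{\aleph_0,|L|\}}$. In particular, the class $\mathcal{M}_L$ of all $L$-isometry classes is a set.
   Context: All metric spaces are assumed to be compact. Given a set $L$, an $L$-labeled metric space is a pair $(X,\alpha)$ where $X$ is a (compact) metric space and $\alpha\colon L\to X$ is an arbitrary map (a labeling). $(X,\alpha)$ and $(Y,\beta)$ are $L$-isometric if there is a (bijective) isometry $h\colon X\to Y$ with $h(\alpha(\ell))=\beta(\ell)$ for all $\ell\in L$. $\mathcal{M}_L$ denotes the class of all $L$-isometry classes of $L$-labeled metric spaces. *)

theory Defs
  imports "HOL-Analysis.Analysis"
begin

unbundle cardinal_syntax

section \<open>Labeled metric spaces\<close>

text \<open>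
  A candidate labeled space over the universe type \<open>'a\<close> is a pair of an abstract metric space
  (carrier a subset of \<open>'a\<close>) and a label function. Two pairs that differ only in distances
  outside the carrier or in labels outside \<open>L\<close> denote the same labeled space;
  \<open>L_isometric\<close> looks at neither, so they lie in the same isometry class.
  The empty metric space is admitted (it can carry a labeling only for \<open>L = {}\<close>).
\<close>

type_synonym ('l, 'a) labeled_metric = "'a metric \<times> ('l \<Rightarrow> 'a)"

definition compact_labeled :: "'l set \<Rightarrow> ('l, 'a) labeled_metric \<Rightarrow> bool" where
  "compact_labeled L S \<longleftrightarrow>
     compact_space (mtopology_of (fst S)) \<and> snd S \<in> L \<rightarrow> mspace (fst S)"

definition L_isometric ::
    "'l set \<Rightarrow> ('l, 'a) labeled_metric \<Rightarrow> ('l, 'b) labeled_metric \<Rightarrow> bool" where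
  "L_isometric L S T \<longleftrightarrow>
     (\<exists>h. bij_betw h (mspace (fst S)) (mspace (fst T)) \<and>
          (\<forall>x \<in> mspace (fst S). \<forall>y \<in> mspace (fst S).
             mdist (fst T) (h x) (h y) = mdist (fst S) x y) \<and>
          (\<forall>l \<in> L. h (snd S l) = snd T l))"

definition L_isometry_rel ::
    "'l set \<Rightarrow> (('l, 'a) labeled_metric \<times> ('l, 'a) labeled_metric) set" where
  "L_isometry_rel L =
     {(S, T). compact_labeled L S \<and> compact_labeled L T \<and> L_isometric L S T}"

definition L_isometry_classes :: "'l set \<Rightarrow> ('l, 'a) labeled_metric set set" where
  "L_isometry_classes L = {S. compact_labeled L S} // L_isometry_rel L"

text \<open>
  HOL has no class of all metric spaces across all types. Compact metric spaces have at most
  continuum many points, so each has an isometric copy carried by a set of reals. Hence the real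
  line is the universe of representatives used for the set of all isometry classes.
\<close>

abbreviation all_L_isometry_classes :: "'l set \<Rightarrow> ('l, real) labeled_metric set set" where
  "all_L_isometry_classes L \<equiv> L_isometry_classes L"

lemma L_isometric_refl: "L_isometric L S S"
  unfolding L_isometric_def by (rule exI[of _ id]) auto

lemma L_isometric_trans:
  assumes "compact_labeled L S" "L_isometric L S T" "L_isometric L T U"
  shows "L_isometric L S U"
proof -
  obtain h where h: "bij_betw h (mspace (fst S)) (mspace (fst T))"
    "\<forall>x \<in> mspace (fst S). \<forall>y \<in> mspace (fst S). mdist (fst T) (h x) (h y) = mdist (fst S) x y"
    "\<forall>l \<in> L. h (snd S l) = snd T l"
    using assms(2) unfolding L_isometric_def by blast
  obtain k where k: "bij_betw k (mspace (fst T)) (mspace (fst U))"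
    "\<forall>x \<in> mspace (fst T). \<forall>y \<in> mspace (fst T). mdist (fst U) (k x) (k y) = mdist (fst T) x y"
    "\<forall>l \<in> L. k (snd T l) = snd U l"
    using assms(3) unfolding L_isometric_def by blast
  have "bij_betw (k \<circ> h) (mspace (fst S)) (mspace (fst U))"
    using bij_betw_trans h(1) k(1) by blast
  moreover have "\<forall>x \<in> mspace (fst S). h x \<in> mspace (fst T)"
    using h(1) bij_betwE by blast
  ultimately show ?thesis
    unfolding L_isometric_def using h k by (intro exI[of _ "k \<circ> h"]) auto
qed

lemma L_isometric_sym:
  assumes "compact_labeled L S" "L_isometric L S T"
  shows "L_isometric L T S"
proof -
  obtain h where h: "bij_betw h (mspace (fst S)) (mspace (fst T))"
    "\<forall>x \<in> mspace (fst S). \<forall>y \<in> mspace (fst S). mdist (fst T) (h x) (h y) = mdist (fst S) x y"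
    "\<forall>l \<in> L. h (snd S l) = snd T l"
    using assms(2) unfolding L_isometric_def by blast
  let ?k = "inv_into (mspace (fst S)) h"
  have k: "bij_betw ?k (mspace (fst T)) (mspace (fst S))"
    using h(1) by (rule bij_betw_inv_into)
  have "?k x \<in> mspace (fst S)" "h (?k x) = x" if "x \<in> mspace (fst T)" for x
    using that k h(1) bij_betwE bij_betw_inv_into_right by fast+
  then have "mdist (fst S) (?k x) (?k y) = mdist (fst T) x y"
    if "x \<in> mspace (fst T)" "y \<in> mspace (fst T)" for x y
    using h(2) that by metis
  moreover have "?k (snd T l) = snd S l" if "l \<in> L" for l
  proof -
    have "snd S l \<in> mspace (fst S)"
      using assms(1) that unfolding compact_labeled_def by auto
    then show ?thesis
      using h(1,3) that bij_betw_inv_into_left by metis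
  qed
  ultimately show ?thesis
    unfolding L_isometric_def using k by blast
qed

lemma equiv_L_isometry_rel: "equiv {S. compact_labeled L S} (L_isometry_rel L)"
proof (rule equivI)
  show "L_isometry_rel L \<subseteq> {S. compact_labeled L S} \<times> {S. compact_labeled L S}"
    by (auto simp: L_isometry_rel_def)
  show "refl_on {S. compact_labeled L S} (L_isometry_rel L)"
    by (auto simp: refl_on_def L_isometry_rel_def L_isometric_refl)
  show "sym (L_isometry_rel L)"
    by (auto simp: sym_def L_isometry_rel_def intro: L_isometric_sym)
  show "trans (L_isometry_rel L)"
    by (auto simp: trans_def L_isometry_rel_def intro: L_isometric_trans)
qed

section \<open>Maximum of two cardinals\<close>

text \<open>
  The larger of two cardinals on possibly different types, moved into the sum type because both
  branches must have the same type.
\<close>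

definition card_max :: "'a rel \<Rightarrow> 'b rel \<Rightarrow> ('a + 'b) rel" where
  "card_max r s = (if r \<le>o s then |Inr ` Field s| else |Inl ` Field r| )"

end

theory Submission
  imports Defs
begin

text \<open>
  Adjoin a dense sequence to the labels of a nonempty compact labeled space. The resulting family
  of points has dense range, so the distances between its members determine the space up to an
  isometry that respects the family. These distances form a subset of a set of cardinality
  \<open>max \<aleph>\<^sub>0 |L|\<close> once each one is replaced by the rationals above it.
\<close>

section \<open>Dense families in compact metric spaces\<close>

text \<open>A family instead of a dense subset: two spaces can then be compared over a common index
  set, and labels can serve as indices.\<close>

definition dense_family :: "'a metric \<Rightarrow> 'i set \<Rightarrow> ('i \<Rightarrow> 'a) \<Rightarrow> bool" where
  "dense_family m I f \<longleftrightarrow>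
     f \<in> I \<rightarrow> mspace m \<and> (\<forall>x \<in> mspace m. \<forall>e > 0. \<exists>i \<in> I. mdist m x (f i) < e)"

text \<open>A compact metric space is totally bounded, so it has finite nets of mesh
  \<open>1/(n+1)\<close>; an enumeration of their union is dense.\<close>

lemma compact_metric_dense_sequence:
  assumes compact: "compact_space (mtopology_of m)" and "mspace m \<noteq> {}"
  obtains s :: "nat \<Rightarrow> 'a" where "dense_family m UNIV s"
proof -
  interpret Metric_space "mspace m" "mdist m"
    by (rule Metric_space_mspace_mdist)
  have "mtotally_bounded (mspace m)"
    using compact unfolding mtopology_of_def
    by (metis compact_space_eq_mcomplete_mtotally_bounded)
  then have "\<forall>n. \<exists>K. finite K \<and> K \<subseteq> mspace m \<and> mspace m \<subseteq> (\<Union>x\<in>K. mball x (inverse (Suc n)))"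
    unfolding mtotally_bounded_def by simp
  then obtain K where K: "\<And>n. finite (K n)" "\<And>n. K n \<subseteq> mspace m"
    "\<And>n. mspace m \<subseteq> (\<Union>x\<in>K n. mball x (inverse (Suc n)))"
    by metis
  let ?D = "\<Union>n. K n"
  have "countable ?D"
    using K(1) by (simp add: countable_finite)
  \<comment> \<open>\<open>from_nat_into\<close> enumerates exactly its countable argument only if
    that set is nonempty.\<close>
  moreover have "?D \<noteq> {}"
    using K(3)[of 0] assms(2) by blast
  ultimately have range: "range (from_nat_into ?D) = ?D"
    by (rule range_from_nat_into[rotated])
  have "\<exists>i. mdist m x (from_nat_into ?D i) < e" if x: "x \<in> mspace m" "e > 0" for x e
  proof -
    obtain n where n: "inverse (real (Suc n)) < e"
      using reals_Archimedean x(2) by blast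
    obtain y where y: "y \<in> K n" "x \<in> mball y (inverse (Suc n))"
      using K(3)[of n] x(1) by blast
    then have "y \<in> range (from_nat_into ?D)"
      unfolding range by blast
    moreover have "mdist m x y < e"
      using n y(2) commute[of x y] by simp
    ultimately show ?thesis by blast
  qed
  then have "dense_family m UNIV (from_nat_into ?D)"
    using range K(2) unfolding dense_family_def by blast
  then show ?thesis by (rule that)
qed

text \<open>Lower bound for the Kuratowski embedding, which maps a point to its distances from the
  family: some \<open>f i\<close> is arbitrarily close to \<open>x\<close>, and at this index the
  bound \<open>r\<close> also controls \<open>x'\<close>.\<close>

lemma dense_family_dist_le:
  assumes "dense_family m I f" "x \<in> mspace m" "x' \<in> mspace m"
    and le: "\<And>i. i \<in> I \<Longrightarrow> \<bar>mdist m x (f i) - mdist m x' (f i)\<bar> \<le> r"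
  shows "mdist m x x' \<le> r"
proof (rule field_le_epsilon)
  fix e :: real
  assume "e > 0"
  interpret Metric_space "mspace m" "mdist m"
    by (rule Metric_space_mspace_mdist)
  \<comment> \<open>Half of \<open>e\<close>, since the distance from \<open>x\<close> to
    \<open>f i\<close> counts twice: directly and in the bound \<open>mdist m x (f i) + r\<close>
    for the distance from \<open>x'\<close> to \<open>f i\<close>.\<close>
  obtain i where i: "i \<in> I" "mdist m x (f i) < e/2" "f i \<in> mspace m"
    using assms(1,2) \<open>e > 0\<close> unfolding dense_family_def by (meson PiE half_gt_zero)
  have "mdist m x x' \<le> mdist m x (f i) + mdist m (f i) x'"
    using triangle i(3) assms(2,3) by blast
  then show "mdist m x x' \<le> r + e"
    using le[OF i(1)] i(2) commute[of x' "f i"] by linarith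
qed

lemma dense_family_point_eq:
  assumes "dense_family m I f" "x \<in> mspace m" "x' \<in> mspace m"
    and "\<And>i. i \<in> I \<Longrightarrow> mdist m x (f i) = mdist m x' (f i)"
  shows "x = x'"
proof -
  have "mdist m x x' \<le> 0"
    using dense_family_dist_le[OF assms(1-3), of 0] assms(4) by simp
  then show ?thesis
    using assms(2,3)
    by (metis Metric_space.nonneg Metric_space.zero Metric_space_mspace_mdist order_antisym)
qed

text \<open>Approximate \<open>x\<close> by members of \<open>f\<close>. The members of
  \<open>g\<close> with the same indices have a convergent subsequence in the compact space
  \<open>m'\<close>, and its limit inherits the distances of \<open>x\<close>.\<close>

lemma dense_family_matching_point:
  assumes f: "dense_family m I f" and g: "g \<in> I \<rightarrow> mspace m'"
    and compact: "compact_space (mtopology_of m')"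
    and dist: "\<And>i j. i \<in> I \<Longrightarrow> j \<in> I \<Longrightarrow> mdist m' (g i) (g j) = mdist m (f i) (f j)"
    and x: "x \<in> mspace m"
  shows "\<exists>y \<in> mspace m'. \<forall>i \<in> I. mdist m' y (g i) = mdist m x (f i)"
proof -
  interpret X: Metric_space "mspace m" "mdist m"
    by (rule Metric_space_mspace_mdist)
  interpret Y: Metric_space "mspace m'" "mdist m'"
    by (rule Metric_space_mspace_mdist)
  have "\<forall>n. \<exists>i \<in> I. mdist m x (f i) < inverse (Suc n)"
    using f x unfolding dense_family_def by simp
  then obtain \<sigma> where \<sigma>: "\<And>n. \<sigma> n \<in> I" "\<And>n. mdist m x (f (\<sigma> n)) < inverse (Suc n)"
    by metis
  have fM: "f i \<in> mspace m" if "i \<in> I" for i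
    using f that unfolding dense_family_def by blast
  have "range (\<lambda>n. g (\<sigma> n)) \<subseteq> mspace m'"
    using g \<sigma>(1) by blast
  then obtain y r where y: "y \<in> mspace m'" "strict_mono (r :: nat \<Rightarrow> nat)"
    "limitin Y.mtopology ((\<lambda>n. g (\<sigma> n)) \<circ> r) y sequentially"
    using compact unfolding mtopology_of_def Y.compact_space_sequentially by meson
  have "(\<lambda>n. mdist m x (f (\<sigma> n))) \<longlonglongrightarrow> 0"
    by (rule tendsto_sandwich[OF _ _ tendsto_const LIMSEQ_inverse_real_of_nat])
      (use \<sigma>(2) in \<open>auto intro: always_eventually less_imp_le\<close>)
  then have limx: "(\<lambda>n. mdist m x (f (\<sigma> (r n)))) \<longlonglongrightarrow> 0"
    using LIMSEQ_subseq_LIMSEQ[OF _ y(2)] unfolding o_def by blast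
  have limy: "(\<lambda>n. mdist m' (g (\<sigma> (r n))) y) \<longlonglongrightarrow> 0"
    using y(3) unfolding Y.limitin_metric_dist_null by (simp add: o_def)
  have "mdist m' y (g i) = mdist m x (f i)" if i: "i \<in> I" for i
  proof -
    \<comment> \<open>With \<open>j = \<sigma> (r n)\<close>, both terms are compared with the
      common value \<open>mdist m' (g j) (g i) = mdist m (f j) (f i)\<close>.\<close>
    have "\<bar>mdist m' y (g i) - mdist m x (f i)\<bar>
        \<le> mdist m x (f (\<sigma> (r n))) + mdist m' (g (\<sigma> (r n))) y" for n
    proof -
      let ?j = "\<sigma> (r n)"
      have j: "?j \<in> I" using \<sigma>(1) .
      have g': "g ?j \<in> mspace m'" "g i \<in> mspace m'" using g i j by auto
      have "mdist m x (f i) \<le> mdist m x (f ?j) + mdist m (f ?j) (f i)"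
        "mdist m (f ?j) (f i) \<le> mdist m x (f ?j) + mdist m x (f i)"
        using X.triangle X.triangle' X.triangle'' fM i j x X.commute by metis+
      moreover have "mdist m' y (g i) \<le> mdist m' (g ?j) y + mdist m' (g ?j) (g i)"
        "mdist m' (g ?j) (g i) \<le> mdist m' (g ?j) y + mdist m' y (g i)"
        using Y.triangle Y.triangle'' g' y(1) by metis+
      ultimately show ?thesis
        using dist[OF j i] by linarith
    qed
    moreover have "(\<lambda>n. mdist m x (f (\<sigma> (r n))) + mdist m' (g (\<sigma> (r n))) y) \<longlonglongrightarrow> 0"
      using tendsto_add[OF limx limy] by simp
    ultimately have "\<bar>mdist m' y (g i) - mdist m x (f i)\<bar> \<le> 0"
      by (intro LIMSEQ_le_const) auto
    then show ?thesis by simp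
  qed
  then show ?thesis using y(1) by blast
qed

text \<open>\<open>h\<close> sends \<open>x\<close> to a point with the same distances to the
  family; by density these distances determine all others.\<close>

lemma dense_family_isometry:
  assumes f: "dense_family m I f" and g: "dense_family m' I g"
    and compact: "compact_space (mtopology_of m)" "compact_space (mtopology_of m')"
    and dist: "\<And>i j. i \<in> I \<Longrightarrow> j \<in> I \<Longrightarrow> mdist m' (g i) (g j) = mdist m (f i) (f j)"
  obtains h where "bij_betw h (mspace m) (mspace m')"
    and "\<And>x y. x \<in> mspace m \<Longrightarrow> y \<in> mspace m \<Longrightarrow> mdist m' (h x) (h y) = mdist m x y"
    and "\<And>i. i \<in> I \<Longrightarrow> h (f i) = g i"
proof -
  have fM: "f \<in> I \<rightarrow> mspace m" and gM: "g \<in> I \<rightarrow> mspace m'"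
    using f g unfolding dense_family_def by auto
  have "\<exists>y \<in> mspace m'. \<forall>i \<in> I. mdist m' y (g i) = mdist m x (f i)" if "x \<in> mspace m" for x
    using dense_family_matching_point[OF f gM compact(2) dist that] .
  then obtain h where h: "\<And>x. x \<in> mspace m \<Longrightarrow> h x \<in> mspace m'"
    "\<And>x i. x \<in> mspace m \<Longrightarrow> i \<in> I \<Longrightarrow> mdist m' (h x) (g i) = mdist m x (f i)"
    by metis
  have "mdist m' (h x) (h y) = mdist m x y" if "x \<in> mspace m" "y \<in> mspace m" for x y
  proof (rule antisym)
    \<comment> \<open>By the reverse triangle inequality the distances of \<open>x\<close> and
      \<open>y\<close> to any \<open>f i\<close> differ by at most \<open>mdist m x y\<close>. They
      carry over to \<open>g\<close>, whose density gives the bound. The converse exchanges the two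
      families.\<close>
    show "mdist m' (h x) (h y) \<le> mdist m x y"
    proof (rule dense_family_dist_le[OF g])
      fix i assume i: "i \<in> I"
      then have "\<bar>mdist m x (f i) - mdist m y (f i)\<bar> \<le> mdist m x y"
        using Metric_space.mdist_reverse_triangle[OF Metric_space_mspace_mdist, of x m "f i" y]
          Metric_space.commute[OF Metric_space_mspace_mdist] fM that by (metis PiE)
      then show "\<bar>mdist m' (h x) (g i) - mdist m' (h y) (g i)\<bar> \<le> mdist m x y"
        using h(2) i that by simp
    qed (use h(1) that in auto)
    show "mdist m x y \<le> mdist m' (h x) (h y)"
    proof (rule dense_family_dist_le[OF f])
      fix i assume i: "i \<in> I"
      then have "\<bar>mdist m' (h x) (g i) - mdist m' (h y) (g i)\<bar> \<le> mdist m' (h x) (h y)"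
        using Metric_space.mdist_reverse_triangle[OF Metric_space_mspace_mdist, of "h x" m' "g i" "h y"]
          Metric_space.commute[OF Metric_space_mspace_mdist] gM h(1) that by (metis PiE)
      then show "\<bar>mdist m x (f i) - mdist m y (f i)\<bar> \<le> mdist m' (h x) (h y)"
        using h(2) i that by simp
    qed (use that in auto)
  qed
  moreover have "bij_betw h (mspace m) (mspace m')"
  proof (rule bij_betw_imageI)
    show "inj_on h (mspace m)"
      using h(2) by (intro inj_onI dense_family_point_eq[OF f]) (auto, metis)
    have "y \<in> h ` mspace m" if y: "y \<in> mspace m'" for y
    proof -
      \<comment> \<open>A preimage comes from matching in the opposite direction, which relies on
        compactness of \<open>m\<close>.\<close>
      obtain x where "x \<in> mspace m" "\<forall>i \<in> I. mdist m x (f i) = mdist m' y (g i)"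
        using dense_family_matching_point[OF g fM compact(1) _ y] dist by metis
      then have "h x = y"
        using h y by (intro dense_family_point_eq[OF g]) auto
      then show ?thesis using \<open>x \<in> mspace m\<close> by blast
    qed
    then show "h ` mspace m = mspace m'"
      using h(1) by blast
  qed
  \<comment> \<open>Both points have distance \<open>mdist m (f i) (f j)\<close> to every
    \<open>g j\<close>.\<close>
  moreover have "h (f i) = g i" if "i \<in> I" for i
    by (rule dense_family_point_eq[OF g]) (use h fM gM dist that in auto)
  ultimately show ?thesis using that by blast
qed

section \<open>Codes of labeled spaces\<close>

text \<open>One fixed choice per metric makes the code below a function of the space. Isometric
  spaces may receive unrelated sequences.\<close>

definition dense_seq :: "'a metric \<Rightarrow> nat \<Rightarrow> 'a" where
  "dense_seq m = (SOME s. dense_family m UNIV s)"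

lemma dense_family_dense_seq:
  assumes "compact_space (mtopology_of m)" "mspace m \<noteq> {}"
  shows "dense_family m UNIV (dense_seq m)"
  unfolding dense_seq_def
  using compact_metric_dense_sequence[OF assms] by (metis someI)

text \<open>Including the labels as indices forces the isometry obtained from equal distances to
  respect them.\<close>

definition labels_and_dense_seq :: "('l, 'a) labeled_metric \<Rightarrow> nat + 'l \<Rightarrow> 'a" where
  "labels_and_dense_seq S = case_sum (dense_seq (fst S)) (snd S)"

lemma dense_family_labels_and_dense_seq:
  assumes "compact_labeled L S" "mspace (fst S) \<noteq> {}"
  shows "dense_family (fst S) (UNIV <+> L) (labels_and_dense_seq S)"
proof -
  have s: "dense_family (fst S) UNIV (dense_seq (fst S))"
    using assms dense_family_dense_seq unfolding compact_labeled_def by blast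
  then have "labels_and_dense_seq S \<in> UNIV <+> L \<rightarrow> mspace (fst S)"
    using assms(1)
    unfolding compact_labeled_def dense_family_def labels_and_dense_seq_def by auto
  moreover have "\<exists>i \<in> UNIV <+> L. mdist (fst S) x (labels_and_dense_seq S i) < e"
    if x: "x \<in> mspace (fst S)" "e > 0" for x e
  proof -
    obtain n where "mdist (fst S) x (dense_seq (fst S) n) < e"
      using s x unfolding dense_family_def by blast
    then show ?thesis
      by (intro bexI[of _ "Inl n"]) (auto simp: labels_and_dense_seq_def)
  qed
  ultimately show ?thesis
    unfolding dense_family_def by blast
qed

text \<open>On the empty space \<open>dense_seq\<close> is a junk value, hence the explicit guard.\<close>

definition labeled_code ::
    "'l set \<Rightarrow> ('l, 'a) labeled_metric \<Rightarrow> ((nat + 'l) \<times> (nat + 'l) \<times> rat) set" where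
  "labeled_code L S =
     {(i, j, q). mspace (fst S) \<noteq> {} \<and> i \<in> UNIV <+> L \<and> j \<in> UNIV <+> L \<and>
        mdist (fst S) (labels_and_dense_seq S i) (labels_and_dense_seq S j) < of_rat q}"

lemma labeled_code_empty_iff: "labeled_code L S = {} \<longleftrightarrow> mspace (fst S) = {}"
proof -
  obtain q where
    "mdist (fst S) (labels_and_dense_seq S (Inl 0)) (labels_and_dense_seq S (Inl 0)) < of_rat q"
    by (meson of_rat_dense less_add_one)
  then have "(Inl 0, Inl 0, q) \<in> labeled_code L S" if "mspace (fst S) \<noteq> {}"
    using that unfolding labeled_code_def by auto
  then show ?thesis
    unfolding labeled_code_def by auto
qed

text \<open>Otherwise a rational strictly between the two numbers would tell them apart.\<close>

lemma real_eq_if_same_rats_above: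
  fixes a b :: real
  assumes "\<And>q. a < of_rat q \<longleftrightarrow> b < of_rat q"
  shows "a = b"
  using assms of_rat_dense by (metis less_asym linorder_neqE)

lemma labeled_code_eq_imp_L_isometric:
  assumes S: "compact_labeled L S" and T: "compact_labeled L T"
    and eq: "labeled_code L S = labeled_code L T"
  shows "L_isometric L S T"
proof (cases "mspace (fst S) = {}")
  case True
  then have "mspace (fst T) = {}"
    using eq labeled_code_empty_iff by metis
  \<comment> \<open>No label can be mapped into an empty carrier.\<close>
  moreover have "L = {}"
    using True S unfolding compact_labeled_def by auto
  ultimately show ?thesis
    using True unfolding L_isometric_def by (auto simp: bij_betw_def)
next
  case False
  then have nonempty: "mspace (fst T) \<noteq> {}"
    using eq labeled_code_empty_iff by metis
  let ?f = "labels_and_dense_seq S" and ?g = "labels_and_dense_seq T"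
  have "mdist (fst T) (?g i) (?g j) = mdist (fst S) (?f i) (?f j)"
    if "i \<in> UNIV <+> L" "j \<in> UNIV <+> L" for i j
  proof (rule real_eq_if_same_rats_above)
    fix q
    have "(i, j, q) \<in> labeled_code L T \<longleftrightarrow> (i, j, q) \<in> labeled_code L S"
      using eq by simp
    then show "mdist (fst T) (?g i) (?g j) < of_rat q \<longleftrightarrow> mdist (fst S) (?f i) (?f j) < of_rat q"
      using that False nonempty unfolding labeled_code_def by simp
  qed
  then obtain h where "bij_betw h (mspace (fst S)) (mspace (fst T))"
    "\<And>x y. x \<in> mspace (fst S) \<Longrightarrow> y \<in> mspace (fst S) \<Longrightarrow>
      mdist (fst T) (h x) (h y) = mdist (fst S) x y"
    and h: "\<And>i. i \<in> UNIV <+> L \<Longrightarrow> h (?f i) = ?g i"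
    using dense_family_isometry[OF dense_family_labels_and_dense_seq[OF S False]
        dense_family_labels_and_dense_seq[OF T nonempty]] S T
    unfolding compact_labeled_def by metis
  \<comment> \<open>The label \<open>l\<close> is the member of the family with index
    \<open>Inr l\<close>.\<close>
  moreover have "h (snd S l) = snd T l" if "l \<in> L" for l
    using h[of "Inr l"] that unfolding labels_and_dense_seq_def by auto
  ultimately show ?thesis
    unfolding L_isometric_def by blast
qed

section \<open>The cardinality bound\<close>

text \<open>The injections \<open>Inl\<close> and \<open>Inr\<close> preserve cardinality, and
  totality of the order on cardinals settles the second branch.\<close>

lemma card_max_upper:
  assumes "Card_order r" "Card_order s"
  shows "Card_order (card_max r s)" "r \<le>o card_max r s" "s \<le>o card_max r s"
proof -
  have r: "r =o |Inl ` Field r :: ('a + 'b) set|" and s: "s =o |Inr ` Field s :: ('a + 'b) set|"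
    using ordIso_transitive[OF ordIso_symmetric[OF card_of_Field_ordIso]]
      card_of_ordIsoI[of Inl "Field r" "Inl ` Field r"]
      card_of_ordIsoI[of Inr "Field s" "Inr ` Field s"] assms
    by (simp_all add: bij_betw_def)
  show "Card_order (card_max r s)"
    unfolding card_max_def by (simp add: card_of_Card_order)
  show "r \<le>o card_max r s" "s \<le>o card_max r s"
    using r s ordLeq_ordIso_trans[of r s] ordLeq_ordIso_trans[of s r] ordIso_imp_ordLeq
      ordLeq_total[of r s] assms
    unfolding card_max_def by (auto simp: card_order_on_def)
qed

text \<open>An infinite cardinal absorbs sums and products of sets no larger than itself; the
  naturals, \<open>L\<close> and the rationals all lie below this one.\<close>

lemma card_code_index_set:
  "|((UNIV :: nat set) <+> L) \<times> ((UNIV :: nat set) <+> L) \<times> (UNIV :: rat set)|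
     \<le>o card_max natLeq |L|"
proof -
  let ?r = "card_max natLeq |L|"
  have r: "Card_order ?r" "natLeq \<le>o ?r" "|L| \<le>o ?r"
    using card_max_upper[OF natLeq_Card_order card_of_Card_order[of L]] by auto
  have inf: "\<not> finite (Field ?r)"
    using cinfinite_mono[OF r(2)] natLeq_cinfinite unfolding cinfinite_def by blast
  have nat: "|UNIV :: nat set| \<le>o ?r"
    using r(2) card_of_nat ordIso_ordLeq_trans by blast
  have "|UNIV :: rat set| \<le>o |UNIV :: nat set|"
    using card_of_ordLeq[of "UNIV :: rat set" "UNIV :: nat set"] inj_to_nat by blast
  then have rat: "|UNIV :: rat set| \<le>o ?r"
    using nat ordLeq_transitive by blast
  have "|(UNIV :: nat set) <+> L| \<le>o ?r"
    using card_of_Plus_ordLeq_infinite_Field[OF inf nat r(3,1)] .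
  then show ?thesis
    by (intro card_of_Times_ordLeq_infinite_Field[OF inf] rat r(1))
qed

lemma card_L_isometry_classes:
  "|L_isometry_classes L :: ('l, 'a) labeled_metric set set| \<le>o ctwo ^c card_max natLeq |L|"
proof -
  let ?B = "((UNIV :: nat set) <+> L) \<times> ((UNIV :: nat set) <+> L) \<times> (UNIV :: rat set)"
  let ?classes = "L_isometry_classes L :: ('l, 'a) labeled_metric set set"
  \<comment> \<open>Isometric spaces may have different codes, so a class is coded through one
    chosen member. Injectivity only requires that equal codes imply
    \<open>L\<close>-isometry.\<close>
  let ?code = "\<lambda>C :: ('l, 'a) labeled_metric set. labeled_code L (SOME S. S \<in> C)"
  have rep: "(SOME S. S \<in> C) \<in> C" if "C \<in> ?classes" for C
    using that in_quotient_imp_non_empty[OF equiv_L_isometry_rel]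
    unfolding L_isometry_classes_def by (metis some_in_eq)
  have comp: "compact_labeled L S" if "C \<in> ?classes" "S \<in> C" for C S
    using that in_quotient_imp_subset[OF equiv_L_isometry_rel]
    unfolding L_isometry_classes_def by blast
  have "inj_on ?code ?classes"
  proof (rule inj_onI)
    fix C D assume CD: "C \<in> ?classes" "D \<in> ?classes" and eq: "?code C = ?code D"
    have "((SOME S. S \<in> C), (SOME S. S \<in> D)) \<in> L_isometry_rel L"
      using labeled_code_eq_imp_L_isometric[OF _ _ eq] comp rep CD
      unfolding L_isometry_rel_def by blast
    then show "C = D"
      using quotient_eqI[OF equiv_L_isometry_rel] rep CD
      unfolding L_isometry_classes_def by metis
  qed
  moreover have "?code ` ?classes \<subseteq> Pow ?B"
    unfolding labeled_code_def by auto
  ultimately have "|?classes| \<le>o |Pow ?B|"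
    using card_of_ordLeq by blast
  also have "|Pow ?B| =o ctwo ^c |?B|"
    using card_of_Pow_Func unfolding ctwo_def cexp_def Field_card_of .
  also have "ctwo ^c |?B| \<le>o ctwo ^c card_max natLeq |L|"
    by (rule cexp_mono2'[OF card_code_index_set Card_order_ctwo]) (simp add: Field_card_of)
  finally show ?thesis .
qed

section \<open>Representatives on the real line\<close>

text \<open>A point is determined by the rationals above its distances to a dense sequence. This
  embeds the space into the subsets of a countable set, which inject into the reals.\<close>

lemma compact_metric_inj_into_reals:
  assumes "compact_space (mtopology_of m)"
  obtains e :: "'a \<Rightarrow> real" where "inj_on e (mspace m)"
proof (cases "mspace m = {}")
  case True
  then show ?thesis using that by simp
next
  case False
  obtain s :: "nat \<Rightarrow> 'a" where s: "dense_family m UNIV s"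
    using compact_metric_dense_sequence[OF assms False] .
  let ?c = "\<lambda>x. {(n, q :: rat). mdist m x (s n) < of_rat q}"
  have "x = y" if "x \<in> mspace m" "y \<in> mspace m" "?c x = ?c y" for x y
    using that(3) real_eq_if_same_rats_above
    by (intro dense_family_point_eq[OF s that(1,2)]) (auto simp: set_eq_iff)
  then have "inj_on ?c (mspace m)"
    by (rule inj_onI)
  moreover have "inj (image (to_nat :: nat \<times> rat \<Rightarrow> nat))"
    by (simp add: inj_image_eq_iff inj_def)
  moreover obtain b :: "nat set \<Rightarrow> real" where "inj b"
    using nat_sets_eqpoll_reals unfolding eqpoll_def bij_betw_def by blast
  ultimately have "inj_on (b \<circ> image to_nat \<circ> ?c) (mspace m)"
    by (metis comp_inj_on inj_on_subset subset_UNIV)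
  then show ?thesis by (rule that)
qed

lemma compact_labeled_real_copy:
  fixes S :: "('l, 'a) labeled_metric"
  assumes S: "compact_labeled L S"
  obtains T :: "('l, real) labeled_metric" where "compact_labeled L T" "L_isometric L S T"
proof -
  let ?m = "fst S"
  interpret X: Metric_space "mspace ?m" "mdist ?m"
    by (rule Metric_space_mspace_mdist)
  obtain e :: "'a \<Rightarrow> real" where e: "inj_on e (mspace ?m)"
    using compact_metric_inj_into_reals S unfolding compact_labeled_def by blast
  let ?k = "inv_into (mspace ?m) e"
  \<comment> \<open>The distance is transported along \<open>e\<close>, so \<open>e\<close> is an
    isometry by construction; the usual distance on the reals plays no part.\<close>
  let ?M = "e ` mspace ?m" and ?d = "\<lambda>a b. mdist ?m (?k a) (?k b)"
  have k: "?k (e x) = x" if "x \<in> mspace ?m" for x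
    using e that by simp
  interpret Y: Metric_space ?M ?d
    by unfold_locales
      (use e in \<open>auto simp: X.commute X.triangle inv_into_into\<close>)
  interpret XY: Metric_space12 "mspace ?m" "mdist ?m" ?M ?d ..
  let ?T = "(metric (?M, ?d), e \<circ> snd S)"
  have "X.mtopology homeomorphic_space Y.mtopology"
    using XY.isometry_imp_homeomorphic_map[of e] k homeomorphic_map_imp_homeomorphic_space
    by auto
  then have "compact_space Y.mtopology"
    using S homeomorphic_compact_space unfolding compact_labeled_def mtopology_of_def by blast
  then have "compact_labeled L ?T"
    using S unfolding compact_labeled_def
    by (auto simp: mtopology_of_def Y.mspace_metric Y.mdist_metric)
  moreover have "L_isometric L S ?T"
    unfolding L_isometric_def using e k
    by (intro exI[of _ e]) (auto simp: Y.mspace_metric Y.mdist_metric bij_betw_def)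
  ultimately show ?thesis by (rule that)
qed

text \<open>The last conjunct expresses that the classes over \<open>real\<close> exhaust the
  isometry classes over any universe type, so that their set stands for all of them.\<close>

theorem theoremB2:
  fixes L :: "'l set"
  shows "|L_isometry_classes L :: ('l, 'a) labeled_metric set set|
           \<le>o ctwo ^c card_max natLeq |L|
    \<and> |all_L_isometry_classes L| \<le>o ctwo ^c card_max natLeq |L|
    \<and> (\<forall>S :: ('l, 'a) labeled_metric. compact_labeled L S \<longrightarrow>
          (\<exists>!C. C \<in> all_L_isometry_classes L \<and> (\<exists>T\<in>C. L_isometric L S T)))"
proof (intro conjI allI impI card_L_isometry_classes)
  fix S :: "('l, 'a) labeled_metric"
  assume S: "compact_labeled L S"
  obtain T :: "('l, real) labeled_metric" where T: "compact_labeled L T" "L_isometric L S T"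
    using compact_labeled_real_copy[OF S] .
  show "\<exists>!C. C \<in> all_L_isometry_classes L \<and> (\<exists>T\<in>C. L_isometric L S T)"
  proof (rule ex1I)
    have "T \<in> L_isometry_rel L `` {T}"
      using T(1) by (simp add: L_isometry_rel_def L_isometric_refl)
    then show "L_isometry_rel L `` {T} \<in> all_L_isometry_classes L \<and>
        (\<exists>T \<in> L_isometry_rel L `` {T}. L_isometric L S T)"
      using T unfolding L_isometry_classes_def by (blast intro: quotientI)
  next
    fix C
    assume "C \<in> all_L_isometry_classes L \<and> (\<exists>T \<in> C. L_isometric L S T)"
    then obtain U where C: "C \<in> {S. compact_labeled L S} // L_isometry_rel L"
      and U: "U \<in> C" "L_isometric L S U"
      unfolding L_isometry_classes_def by blast
    \<comment> \<open>Uniqueness: \<open>T\<close> and \<open>U\<close> are both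
      \<open>L\<close>-isometric to \<open>S\<close>, hence to each other, and so their classes
      coincide.\<close>
    have "L_isometric L T U"
      using L_isometric_trans[OF T(1) L_isometric_sym[OF S T(2)] U(2)] .
    moreover have "compact_labeled L U"
      using in_quotient_imp_subset[OF equiv_L_isometry_rel C] U(1) by blast
    ultimately have TU: "(T, U) \<in> L_isometry_rel L"
      using T(1) unfolding L_isometry_rel_def by blast
    have T_class: "L_isometry_rel L `` {T} \<in> {S. compact_labeled L S} // L_isometry_rel L"
      using T(1) by (simp add: quotientI)
    have "T \<in> L_isometry_rel L `` {T}"
      using T(1) by (simp add: L_isometry_rel_def L_isometric_refl)
    then show "C = L_isometry_rel L `` {T}"
      using quotient_eqI[OF equiv_L_isometry_rel T_class C _ U(1) TU] by simp
  qed
qed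

end
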